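(* Let $S_n=\{P_n(2,a,b)\mid a+b=n-3,\ 1\le a\le b\}$, and write $P_n(2,a,* )$ for $P_n(2,a,n-3-a)$. Let $k=\lfloor\frac{n-3}{2}\rfloor$, $t=\lfloor\frac{k}{2}\rfloor$ and $l=\lfloor\frac{k-1}{2}\rfloor$. Then the trees of $S_n$ are totally ordered as $$P_n(2,2,* )\succ P_n(2,4,* )\succ\cdots\succ P_n(2,2t,* )\succ P_n(2,2l+1,* )\succ\cdots\succ P_n(2,3,* )\succ P_n(2,1,* ).$$
   Context: $P_n(a_1,\dots,a_k)$ ($k\ge3$, $a_i\ge1$, $\sum a_i=n-1$) is the tree of order $n$ consisting of a central vertex with $k$ internally disjoint pendent paths of lengths $a_1,\dots,a_k$. For trees $T_1,T_2$ of the same order, $T_1\prec T_2$ (equivalently $T_2\succ T_1$) means $m(T_1,i)\le m(T_2,i)$ for all $i$ with strict inequality for some $i$, where $m(T,i)$ is the number of $i$-matchings of $T$ (these are the absolute values of the coefficients of the characteristic polynomial of the adjacency matrix). *)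

theory Defs
  imports Main "HOL-Library.Disjoint_Sets"
begin

record 'v sgraph =
  verts :: "'v set"
  edges :: "'v set set"

definition simple_graph :: "'v sgraph \<Rightarrow> bool" where
  "simple_graph G \<longleftrightarrow>
     finite (verts G) \<and> (\<forall>e\<in>edges G. e \<subseteq> verts G \<and> card e = 2)"

definition connected_graph :: "'v sgraph \<Rightarrow> bool" where
  "connected_graph G \<longleftrightarrow> verts G \<noteq> {} \<and>
     (\<forall>u\<in>verts G. \<forall>v\<in>verts G. (u, v) \<in> {(x, y). {x, y} \<in> edges G}\<^sup>*)"

text \<open>A cycle is given by its distinct vertices in cyclic order.\<close>

definition cycle_of :: "'v sgraph \<Rightarrow> 'v list \<Rightarrow> bool" where
  "cycle_of G c \<longleftrightarrow> 3 \<le> length c \<and> distinct c \<and>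
     (\<forall>i<length c. {c ! i, c ! (Suc i mod length c)} \<in> edges G)"

definition tree_graph :: "'v sgraph \<Rightarrow> bool" where
  "tree_graph G \<longleftrightarrow> simple_graph G \<and> connected_graph G \<and> (\<nexists>c. cycle_of G c)"

definition matchings :: "'v sgraph \<Rightarrow> nat \<Rightarrow> 'v set set set" where
  "matchings G i = {M. M \<subseteq> edges G \<and> disjoint M \<and> card M = i}"

definition num_matchings :: "'v sgraph \<Rightarrow> nat \<Rightarrow> nat" where
  "num_matchings G i = card (matchings G i)"

text \<open>The relation is only meant for trees of the same order, so this is part of its definition.\<close>

definition match_less :: "'v sgraph \<Rightarrow> 'w sgraph \<Rightarrow> bool"  (infix \<open>\<prec>\<^sub>m\<close> 50) where
  "T1 \<prec>\<^sub>m T2 \<longleftrightarrow>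
     tree_graph T1 \<and> tree_graph T2 \<and> card (verts T1) = card (verts T2) \<and>
     (\<forall>i. num_matchings T1 i \<le> num_matchings T2 i) \<and>
     (\<exists>i. num_matchings T1 i < num_matchings T2 i)"

abbreviation match_greater :: "'v sgraph \<Rightarrow> 'w sgraph \<Rightarrow> bool"  (infix \<open>\<succ>\<^sub>m\<close> 50) where
  "T2 \<succ>\<^sub>m T1 \<equiv> T1 \<prec>\<^sub>m T2"

text \<open>
  The tree \<open>P\<^sub>n(a\<^sub>1,\<dots>,a\<^sub>k)\<close> for the list \<open>as = [a\<^sub>1,\<dots>,a\<^sub>k]\<close>. The central vertex is \<open>None\<close>, and
  \<open>Some (i, 0), \<dots>, Some (i, as ! i - 1)\<close> are the vertices of the \<open>i\<close>-th pendent path,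
  listed away from the centre. The order \<open>n = 1 + a\<^sub>1 + \<dots> + a\<^sub>k\<close> is determined by the
  list (lemma \<open>card_verts_pendent_paths\<close>) and is not an argument.
\<close>

definition pendent_paths :: "nat list \<Rightarrow> (nat \<times> nat) option sgraph" where
  "pendent_paths as =
     \<lparr>verts = insert None {Some (i, j) |i j. i < length as \<and> j < as ! i},
      edges = {{None, Some (i, 0)} |i. i < length as \<and> 0 < as ! i} \<union>
              {{Some (i, j), Some (i, Suc j)} |i j. i < length as \<and> Suc j < as ! i}\<rparr>"

definition S :: "nat \<Rightarrow> (nat \<times> nat) option sgraph set" where
  "S n = {pendent_paths [2, a, b] |a b. a + b = n - 3 \<and> 1 \<le> a \<and> a \<le> b}"

text \<open>\<open>P2 n a\<close> is \<open>P\<^sub>n(2,a,*) = P\<^sub>n(2,a,n-3-a)\<close>.\<close>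

definition P2 :: "nat \<Rightarrow> nat \<Rightarrow> (nat \<times> nat) option sgraph" where
  "P2 n a = pendent_paths [2, a, n - 3 - a]"

lemma card_verts_pendent_paths: "card (verts (pendent_paths as)) = Suc (sum_list as)"
proof -
  have eq: "{Some (i, j) |i j. i < length as \<and> j < as ! i} =
      Some ` (SIGMA i:{..<length as}. {..<as ! i})" by auto
  have "card (SIGMA i:{..<length as}. {..<as ! i}) = sum_list as"
    by (simp add: sum_list_sum_nth lessThan_atLeast0)
  then have "card {Some (i, j) |i j. i < length as \<and> j < as ! i} = sum_list as"
    unfolding eq by (simp add: card_image)
  moreover have "finite {Some (i, j) |i j. i < length as \<and> j < as ! i}"
    unfolding eq by auto
  ultimately show ?thesis by (auto simp: pendent_paths_def card_insert_if)
qed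

lemma simple_graph_pendent_paths: "simple_graph (pendent_paths as)"
proof -
  have "{Some (i, j) |i j. i < length as \<and> j < as ! i} =
      Some ` (SIGMA i:{..<length as}. {..<as ! i})" by auto
  then have "finite {Some (i, j) |i j. i < length as \<and> j < as ! i}" by auto
  then show ?thesis by (auto simp: simple_graph_def pendent_paths_def)
qed

lemma connected_graph_pendent_paths: "connected_graph (pendent_paths as)"
proof -
  let ?G = "pendent_paths as"
  let ?R = "{(x, y). {x, y} \<in> edges ?G}"
  have "sym ?R" by (auto simp: sym_def insert_commute)
  then have s: "sym (?R\<^sup>*)" by (rule sym_rtrancl)
  have reach: "(None, Some (i, j)) \<in> ?R\<^sup>*" if "i < length as" "j < as ! i" for i j
    using that(2)
  proof (induction j)
    case 0
    then show ?case using that(1) by (intro r_into_rtrancl) (auto simp: pendent_paths_def)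
  next
    case (Suc j)
    then have "(Some (i, j), Some (i, Suc j)) \<in> ?R"
      using that(1) by (auto simp: pendent_paths_def)
    then show ?case using Suc by (meson Suc_lessD rtrancl.rtrancl_into_rtrancl)
  qed
  then have "(None, v) \<in> ?R\<^sup>*" if "v \<in> verts ?G" for v
    using that by (auto simp: pendent_paths_def)
  then have "(u, v) \<in> ?R\<^sup>*" if "u \<in> verts ?G" "v \<in> verts ?G" for u v
    using that s by (meson rtrancl_trans symD)
  then show ?thesis by (auto simp: connected_graph_def pendent_paths_def)
qed

lemma acyclic_pendent_paths: "\<not> cycle_of (pendent_paths as) c"
proof
  let ?G = "pendent_paths as"
  let ?n = "length c"
  define d :: "(nat \<times> nat) option \<Rightarrow> nat"
    where "d x = (case x of None \<Rightarrow> 0 | Some (i, j) \<Rightarrow> Suc j)" for x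
  define p :: "(nat \<times> nat) option \<Rightarrow> (nat \<times> nat) option"
    where "p x = (case x of None \<Rightarrow> None | Some (i, j) \<Rightarrow> if j = 0 then None else Some (i, j - 1))"
    for x
  have par: "y = p x" if "{x, y} \<in> edges ?G" "d y \<le> d x" for x y
    using that by (auto simp: pendent_paths_def d_def p_def doubleton_eq_iff)
  assume c: "cycle_of ?G c"
  then have n: "3 \<le> ?n" and dist: "distinct c"
    and e: "\<And>i. i < ?n \<Longrightarrow> {c ! i, c ! (Suc i mod ?n)} \<in> edges ?G"
    by (auto simp: cycle_of_def)
  have fin: "finite ((\<lambda>i. d (c ! i)) ` {..<?n})" "(\<lambda>i. d (c ! i)) ` {..<?n} \<noteq> {}"
    using n by (auto simp: lessThan_empty_iff)
  obtain m where m: "m < ?n" "\<And>i. i < ?n \<Longrightarrow> d (c ! i) \<le> d (c ! m)"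
    using Max_in[OF fin] Max_ge[OF fin(1)] by fastforce
  define q where "q = (if m = 0 then ?n - 1 else m - 1)"
  define s where "s = Suc m mod ?n"
  have q: "q < ?n" "Suc q mod ?n = m" using n m(1) by (auto simp: q_def)
  have s: "s < ?n" using n by (auto simp: s_def intro: mod_less_divisor)
  have "c ! s = p (c ! m)" using e[OF m(1)] m(2)[OF s] par by (simp add: s_def)
  moreover have "c ! q = p (c ! m)"
    using e[OF q(1)] m(2)[OF q(1)] par q(2) by (simp add: insert_commute)
  ultimately have "s = q" using dist q(1) s by (metis nth_eq_iff_index_eq)
  then show False using n m(1) by (cases "Suc m = ?n") (auto simp: q_def s_def split: if_splits)
qed

lemma tree_graph_pendent_paths: "tree_graph (pendent_paths as)"
  by (simp add: tree_graph_def simple_graph_pendent_paths connected_graph_pendent_paths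
      acyclic_pendent_paths)

end

theory Submission
  imports Defs "HOL-Computational_Algebra.Polynomial"
begin

text \<open>
  Let \<open>p\<^sub>m\<close> be the matching generating polynomial of the path on \<open>m\<close> vertices. Deleting the edge
  joining the centre to the pendent path of length 2 shows that \<open>P\<^sub>n(2,a,b)\<close> has generating polynomial
  \<open>p\<^sub>2 p\<^bsub>a+b+1\<^esub> + x p\<^sub>a p\<^sub>b\<close>, so only the products \<open>p\<^sub>a p\<^sub>b\<close> with \<open>a + b = n - 3\<close> have to be compared.
  From \<open>p\<^bsub>a+b\<^esub> = p\<^sub>a p\<^sub>b + x p\<^bsub>a-1\<^esub> p\<^bsub>b-1\<^esub>\<close>, lowering all indices by one turns the difference of two
  such products into its multiple by \<open>-1/x\<close>. Hence for \<open>a < c \<le> d < b\<close> and \<open>a + b = c + d\<close> the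
  difference \<open>p\<^sub>a p\<^sub>b - p\<^sub>c p\<^sub>d\<close> is \<open>(-1)\<^sup>a\<close> times a nonzero polynomial with nonnegative coefficients: the
  parity of the smaller index decides which tree is larger.
\<close>

section \<open>Matching generating polynomials\<close>

definition matching_poly :: "'v set set \<Rightarrow> int poly" where
  "matching_poly E = (\<Sum>M | M \<subseteq> E \<and> disjoint M. monom 1 (card M))"

lemma coeff_matching_poly:
  assumes "finite (edges G)"
  shows "coeff (matching_poly (edges G)) i = int (num_matchings G i)"
proof -
  have "coeff (matching_poly (edges G)) i =
      (\<Sum>M | M \<subseteq> edges G \<and> disjoint M. if card M = i then 1 else 0)"
    by (simp add: matching_poly_def coeff_sum)
  also have "\<dots> = int (card ({M. M \<subseteq> edges G \<and> disjoint M} \<inter> {M. card M = i}))"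
    using assms by (subst sum.If_cases) (auto intro: finite_subset[of _ "Pow (edges G)"])
  also have "{M. M \<subseteq> edges G \<and> disjoint M} \<inter> {M. card M = i} = matchings G i"
    by (auto simp: matchings_def)
  finally show ?thesis by (simp add: num_matchings_def)
qed

lemma matching_poly_empty [simp]: "matching_poly {} = 1"
proof -
  have "{M. M \<subseteq> {} \<and> disjoint M} = {{} :: 'a set set}" by auto
  then show ?thesis by (simp add: matching_poly_def)
qed

text \<open>Matchings avoiding \<open>e\<close> are those of \<open>E\<close>; deleting
  \<open>e\<close> from the others leaves exactly the matchings of edges disjoint from
  \<open>e\<close>, at the price of one factor x.\<close>

lemma matching_poly_insert:
  assumes "finite E" "e \<notin> E"
  shows "matching_poly (insert e E) =
    matching_poly E + monom 1 1 * matching_poly {f \<in> E. f \<inter> e = {}}"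
proof -
  let ?A = "{M. M \<subseteq> E \<and> disjoint M}"
  let ?B = "{M. M \<subseteq> {f \<in> E. f \<inter> e = {}} \<and> disjoint M}"
  have fin: "finite ?A" "finite ?B"
    using assms(1) by (auto intro: finite_subset[of _ "Pow E"])
  have "M \<in> ?A \<union> insert e ` ?B" if "M \<subseteq> insert e E" "disjoint M" for M
  proof (cases "e \<in> M")
    case True
    then have "M - {e} \<in> ?B" "M = insert e (M - {e})"
      using that by (auto simp: disjoint_def)
    then show ?thesis by blast
  next
    case False
    then show ?thesis using that by auto
  qed
  moreover have "disjoint (insert e M)" if "M \<in> ?B" for M
    using that by (auto simp: disjoint_def)
  ultimately have split: "{M. M \<subseteq> insert e E \<and> disjoint M} = ?A \<union> insert e ` ?B"
    by auto
  have inj: "inj_on (insert e) ?B" using assms(2) by (auto simp: inj_on_def)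
  have card: "card (insert e M) = Suc (card M)" if "M \<in> ?B" for M
    using that assms by (subst card_insert_disjoint) (auto intro: finite_subset[of M E])
  have "matching_poly (insert e E) =
      matching_poly E + (\<Sum>M\<in>insert e ` ?B. monom 1 (card M))"
    unfolding matching_poly_def split
    using fin assms(2) by (subst sum.union_disjoint) auto
  also have "(\<Sum>M\<in>insert e ` ?B. monom (1 :: int) (card M)) = (\<Sum>M\<in>?B. monom 1 1 * monom 1 (card M))"
    unfolding sum.reindex[OF inj] by (rule sum.cong) (simp_all add: card mult_monom)
  finally show ?thesis by (simp add: matching_poly_def sum_distrib_left)
qed

text \<open>Induction on the size of \<open>E\<close>: the edge recursion at some \<open>e\<close>
  in \<open>E\<close> leaves \<open>F\<close> untouched, because no vertex of \<open>e\<close> lies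
  on an edge of \<open>F\<close>.\<close>

lemma matching_poly_Un:
  assumes "finite E" "finite F" "{} \<notin> F" "\<Union>E \<inter> \<Union>F = {}"
  shows "matching_poly (E \<union> F) = matching_poly E * matching_poly F"
  using assms(1,4)
proof (induction "card E" arbitrary: E rule: less_induct)
  case less
  show ?case
  proof (cases "E = {}")
    case True
    then show ?thesis by simp
  next
    case False
    then obtain e E' where E: "E = insert e E'" "e \<notin> E'" by (meson Set.set_insert ex_in_conv)
    let ?E'' = "{f \<in> E'. f \<inter> e = {}}"
    have E': "finite E'" using less.prems E by simp
    have "card E' < card E" "card ?E'' < card E"
      using E E' card_mono[of E' ?E''] by (auto simp: less_Suc_eq_le)
    then have IH: "matching_poly (E' \<union> F) = matching_poly E' * matching_poly F"
        "matching_poly (?E'' \<union> F) = matching_poly ?E'' * matching_poly F"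
      using less.hyps[of E'] less.hyps[of ?E''] less.prems E E' by auto
    \<comment> \<open>Disjoint vertex sets exclude only a common nonempty edge; the empty one is
      excluded by \<open>{} \<notin> F\<close>.\<close>
    have "e \<notin> F" using less.prems(2) assms(3) E by (cases "e = {}") auto
    moreover have "{f \<in> E' \<union> F. f \<inter> e = {}} = ?E'' \<union> F" using less.prems(2) E by auto
    ultimately show ?thesis
      using E E' assms(2)
      by (simp add: matching_poly_insert IH ring_distribs mult.assoc)
  qed
qed

section \<open>Paths\<close>

text \<open>The argument counts vertices, not edges, so both 0 and 1 give an edgeless graph. The
  recursion is on the last edge; these are Fibonacci-type polynomials.\<close>

fun path_poly :: "nat \<Rightarrow> int poly" where
  "path_poly 0 = 1"
| "path_poly (Suc 0) = 1"
| "path_poly (Suc (Suc m)) = path_poly (Suc m) + monom 1 1 * path_poly m"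

definition path_edges :: "(nat \<Rightarrow> 'v) \<Rightarrow> nat \<Rightarrow> 'v set set" where
  "path_edges v m = {{v j, v (Suc j)} |j. Suc j < m}"

lemma finite_path_edges [simp]: "finite (path_edges v m)"
  unfolding path_edges_def by (rule finite_image_set) (auto intro: finite_subset[of _ "{..<m}"])

lemma matching_poly_path_edges:
  assumes "inj_on v {..<m}"
  shows "matching_poly (path_edges v m) = path_poly m"
  using assms
proof (induction m rule: path_poly.induct)
  case (3 m)
  let ?e = "{v m, v (Suc m)}"
  have inj: "v i = v j \<longleftrightarrow> i = j" if "i < Suc (Suc m)" "j < Suc (Suc m)" for i j
    using 3(3) that by (auto simp: inj_on_def)
  have "path_edges v (Suc (Suc m)) = insert ?e (path_edges v (Suc m))"
    by (auto simp: path_edges_def less_Suc_eq)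
  moreover have "?e \<notin> path_edges v (Suc m)"
    by (auto simp: path_edges_def doubleton_eq_iff inj)
  moreover have "{f \<in> path_edges v (Suc m). f \<inter> ?e = {}} = path_edges v m"
    by (auto simp: path_edges_def inj)
  moreover have "inj_on v {..<Suc m}" "inj_on v {..<m}"
    using 3(3) by (simp_all add: inj_on_def)
  ultimately show ?case using 3 by (simp add: matching_poly_insert)
qed (simp_all add: path_edges_def)

text \<open>This is the edge recursion at an inner edge, with m + 1 vertices on one side and k + 1
  on the other; using that edge removes both of its ends.\<close>

lemma path_poly_add:
  "path_poly (m + k + 2) = path_poly (m + 1) * path_poly (k + 1) + monom 1 1 * (path_poly m * path_poly k)"
proof (induction m rule: path_poly.induct)
  case (3 m)
  then show ?case by (simp add: algebra_simps)
qed (simp_all add: algebra_simps)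

text \<open>With c = a + 1 + u and d = a + 1 + w, the complementary index c + d - a is a + u + w +
  2; recording the gaps \<open>u\<close> and \<open>w\<close> avoids truncated subtraction and keeps
  them fixed in the induction on \<open>a\<close>.\<close>

lemma path_poly_mult_diff:
  "path_poly a * path_poly (a + u + w + 2) - path_poly (a + 1 + u) * path_poly (a + 1 + w) =
    (-1) ^ a * (monom 1 (a + 1) * (path_poly u * path_poly w))"
proof (induction a)
  case 0
  show ?case using path_poly_add[of u w] by simp
next
  case (Suc a)
  \<comment> \<open>One path on 2a + u + w + 4 vertices is split at two different edges; equating
    the two expansions moves the difference at \<open>Suc a\<close> to the one at
    \<open>a\<close>.\<close>
  have "path_poly (a + (a + u + w + 2) + 2) = path_poly ((a + 1 + u) + (a + 1 + w) + 2)"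
    by (rule arg_cong[where f = path_poly]) simp
  then have "path_poly (Suc a) * path_poly (Suc a + u + w + 2) -
        path_poly (Suc a + 1 + u) * path_poly (Suc a + 1 + w) =
      - monom 1 1 * (path_poly a * path_poly (a + u + w + 2) - path_poly (a + 1 + u) * path_poly (a + 1 + w))"
    unfolding path_poly_add[of a "a + u + w + 2"] path_poly_add[of "a + 1 + u" "a + 1 + w"]
    by (simp add: right_diff_distrib algebra_simps del: path_poly.simps)
  also have "\<dots> = (-1) ^ Suc a * ((monom 1 1 * monom 1 (a + 1)) * (path_poly u * path_poly w))"
    unfolding Suc.IH by (simp add: algebra_simps)
  finally show ?case by (simp add: mult_monom)
qed

lemma coeff_path_poly_nonneg: "0 \<le> coeff (path_poly m) i"
  by (induction m arbitrary: i rule: path_poly.induct) (auto simp: coeff_monom_mult)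

lemma coeff_0_path_poly: "coeff (path_poly m) 0 = 1"
  by (induction m rule: path_poly.induct) (auto simp: coeff_monom_mult)

section \<open>Comparing the trees \<open>P\<^sub>n(2,a,b)\<close>\<close>

lemma finite_edges: "simple_graph G \<Longrightarrow> finite (edges G)"
  by (rule finite_subset[of _ "Pow (verts G)"]) (auto simp: simple_graph_def)

lemma matching_poly_pendent_paths:
  "matching_poly (edges (pendent_paths [2, a, b])) =
    path_poly 2 * path_poly (a + b + 1) + monom 1 1 * (path_poly a * path_poly b)"
proof -
  \<comment> \<open>the path formed by the two long legs and the centre, which is \<open>v a\<close>\<close>
  define v :: "nat \<Rightarrow> (nat \<times> nat) option"
    where "v j = (if j < a then Some (1, a - 1 - j) else if j = a then None else Some (2, j - a - 1))" for j
  define w where "w j = v (a + 1 + j)" for j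
  define leg :: "nat \<Rightarrow> (nat \<times> nat) option" where "leg j = Some (0, j)" for j
  let ?e = "{None, Some (0, 0)} :: (nat \<times> nat) option set"
  let ?F = "path_edges leg 2 \<union> path_edges v (a + b + 1)"
  have inj: "inj v" by (auto simp: inj_on_def v_def split: if_splits)
  then have inj': "inj w" by (fastforce simp: w_def intro: injI dest: injD)
  have leg: "inj leg" by (auto simp: inj_on_def leg_def)
  have path2: "path_edges leg 2 = {{Some (0, 0), Some (0, 1)}}"
    by (auto simp: path_edges_def leg_def)
  \<comment> \<open>The dummy \<open>j\<close> makes each centre edge a singleton set or, for a leg
    of length 0, the empty set.\<close>
  have spine: "path_edges v (a + b + 1) =
      {{Some (1, j), Some (1, Suc j)} |j. Suc j < a} \<union> {{None, Some (1, 0)} |j::nat. 0 < a} \<union>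
      {{None, Some (2, 0)} |j::nat. 0 < b} \<union> {{Some (2, j), Some (2, Suc j)} |j. Suc j < b}"
    (is "?L = ?R")
  proof
    show "?L \<subseteq> ?R"
    proof
      fix f assume "f \<in> ?L"
      then obtain j where f: "f = {v j, v (Suc j)}" and j: "j < a + b"
        by (auto simp: path_edges_def)
      consider "Suc j < a" | "Suc j = a" | "j = a" | "a < j" by linarith
      then show "f \<in> ?R"
      proof cases
        case 1
        then have "f = {Some (1, a - 1 - Suc j), Some (1, Suc (a - 1 - Suc j))}"
          by (simp add: f v_def insert_commute Suc_diff_Suc)
        moreover have "Suc (a - 1 - Suc j) < a" using 1 by simp
        ultimately show ?thesis by blast
      next
        case 4
        then have "f = {Some (2, j - a - 1), Some (2, Suc (j - a - 1))}"
          using 4 by (simp add: f v_def Suc_diff_Suc)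
        moreover have "Suc (j - a - 1) < b" using 4 j by simp
        ultimately show ?thesis by blast
      qed (use f j in \<open>auto simp: v_def\<close>)
    qed
    have in_L: "{v j, v (Suc j)} \<in> ?L" if "j < a + b" for j
      using that by (auto simp: path_edges_def)
    \<comment> \<open>\<open>v\<close> traverses leg 1 towards the centre, so the positions are
      reversed: \<open>v (a - 2 - j)\<close> is \<open>Some (1, Suc j)\<close>.\<close>
    have "{Some (1, j), Some (1, Suc j)} \<in> ?L" if "Suc j < a" for j
      using in_L[of "a - 2 - j"] that by (simp add: v_def insert_commute Suc_diff_Suc numeral_2_eq_2)
    moreover have "{None, Some (1, 0)} \<in> ?L" if "0 < a"
      using in_L[of "a - 1"] that by (simp add: v_def insert_commute)
    moreover have "{None, Some (2, 0)} \<in> ?L" if "0 < b"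
      using in_L[of a] that by (simp add: v_def)
    moreover have "{Some (2, j), Some (2, Suc j)} \<in> ?L" if "Suc j < b" for j
      using in_L[of "a + 1 + j"] that by (simp add: v_def)
    ultimately show "?R \<subseteq> ?L" by blast
  qed
  have edges: "edges (pendent_paths [2, a, b]) = insert ?e ?F"
  proof (rule set_eqI)
    fix f
    have ex_3: "(\<exists>i<3. P i) \<longleftrightarrow> P 0 \<or> P 1 \<or> P 2" for P :: "nat \<Rightarrow> bool"
      by (auto simp: numeral_eq_Suc less_Suc_eq)
    have less_2: "Suc j < 2 \<longleftrightarrow> j = 0" for j by auto
    have "f \<in> edges (pendent_paths [2, a, b]) \<longleftrightarrow>
        (\<exists>i<3. f = {None, Some (i, 0)} \<and> 0 < [2, a, b] ! i \<or>
          (\<exists>j. f = {Some (i, j), Some (i, Suc j)} \<and> Suc j < [2, a, b] ! i))"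
      unfolding pendent_paths_def by (simp add: numeral_3_eq_3) blast
    also have "\<dots> \<longleftrightarrow> f \<in> insert ?e ?F"
      unfolding path2 spine ex_3 by (simp add: less_2 disj_ac)
    finally show "f \<in> edges (pendent_paths [2, a, b]) \<longleftrightarrow> f \<in> insert ?e ?F" .
  qed
  \<comment> \<open>The other edge of the short leg meets \<open>?e\<close> in
    \<open>Some (0, 0)\<close> and drops out; losing the centre cuts the spine into the two long
    legs.\<close>
  have rest: "{f \<in> ?F. f \<inter> ?e = {}} = path_edges v a \<union> path_edges w b" (is "?L = ?R")
  proof
    have v_None: "v j = None \<longleftrightarrow> j = a" for j by (simp add: v_def)
    have v_0: "v j \<noteq> Some (0, i)" for i j by (simp add: v_def)
    show "?L \<subseteq> ?R"
    proof
      fix f assume "f \<in> ?L"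
      then have "f \<in> path_edges v (a + b + 1)" "None \<notin> f"
        unfolding path2 by auto
      then obtain j where "f = {v j, v (Suc j)}" "j < a + b" by (auto simp: path_edges_def)
      moreover have "j \<noteq> a" "Suc j \<noteq> a"
        using \<open>None \<notin> f\<close> v_None[of j] v_None[of "Suc j"] calculation(1) by auto
      ultimately have f: "f = {v j, v (Suc j)}" "j < a + b" "j \<noteq> a" "Suc j \<noteq> a" .
      show "f \<in> ?R"
      proof (cases "j < a")
        case True
        then show ?thesis using f by (auto simp: path_edges_def)
      next
        case False
        then have "f = {w (j - a - 1), w (Suc (j - a - 1))}" "Suc (j - a - 1) < b"
          using f by (auto simp: w_def)
        then show ?thesis by (auto simp: path_edges_def)
      qed
    qed
    show "?R \<subseteq> ?L"
    proof
      fix f assume "f \<in> ?R"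
      moreover have "\<exists>j. f = {v j, v (Suc j)} \<and> j < a + b \<and> j \<noteq> a \<and> Suc j \<noteq> a"
        if "f \<in> path_edges w b"
      proof -
        from that obtain j where "f = {w j, w (Suc j)}" "Suc j < b"
          by (auto simp: path_edges_def)
        then show ?thesis by (intro exI[of _ "a + 1 + j"]) (simp add: w_def)
      qed
      ultimately obtain j where f: "f = {v j, v (Suc j)}" "j < a + b" "j \<noteq> a" "Suc j \<noteq> a"
        by (fastforce simp: path_edges_def)
      then have "f \<in> path_edges v (a + b + 1)" by (auto simp: path_edges_def)
      moreover have "f \<inter> ?e = {}" using f v_None v_0 by auto
      ultimately show "f \<in> ?L" by blast
    qed
  qed
  have "matching_poly ?F = path_poly 2 * path_poly (a + b + 1)"
    using inj_on_subset[OF inj] inj_on_subset[OF leg]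
    by (subst matching_poly_Un)
      (auto simp: matching_poly_path_edges, auto simp: path_edges_def leg_def v_def split: if_splits)
  moreover have "matching_poly (path_edges v a \<union> path_edges w b) = path_poly a * path_poly b"
    using inj_on_subset[OF inj] inj_on_subset[OF inj']
    by (subst matching_poly_Un)
      (auto simp: matching_poly_path_edges, auto simp: path_edges_def w_def v_def split: if_splits)
  moreover have "?e \<notin> ?F"
    by (auto simp: path_edges_def leg_def v_def doubleton_eq_iff)
  ultimately show ?thesis
    unfolding edges by (subst matching_poly_insert) (simp_all only: rest finite_Un finite_path_edges simp_thms)
qed

text \<open>Equal sums make the terms with \<open>path_poly 2\<close> cancel, so the matching
  numbers differ by the coefficients of x times the given difference.\<close>

lemma match_less_pendent_pathsI:
  assumes "a + b = c + d"
    and "path_poly a * path_poly b - path_poly c * path_poly d =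
      monom 1 r * (path_poly u * path_poly w)"
  shows "pendent_paths [2, c, d] \<prec>\<^sub>m pendent_paths [2, a, b]"
proof -
  let ?m = "\<lambda>a b i. int (num_matchings (pendent_paths [2, a, b]) i)"
  have "matching_poly (edges (pendent_paths [2, a, b])) - matching_poly (edges (pendent_paths [2, c, d])) =
      monom 1 1 * (path_poly a * path_poly b - path_poly c * path_poly d)"
    by (simp add: matching_poly_pendent_paths assms(1) algebra_simps)
  also have "\<dots> = monom 1 (Suc r) * (path_poly u * path_poly w)"
    unfolding assms(2) by (simp add: mult_monom flip: mult.assoc)
  finally have diff: "?m a b i - ?m c d i = coeff (monom 1 (Suc r) * (path_poly u * path_poly w)) i" for i
    by (metis coeff_diff coeff_matching_poly finite_edges simple_graph_pendent_paths)
  have "0 \<le> ?m a b i - ?m c d i" for i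
    unfolding diff coeff_monom_mult coeff_mult
    by (auto intro!: sum_nonneg mult_nonneg_nonneg coeff_path_poly_nonneg)
  \<comment> \<open>Strictness comes from the lowest term: both path polynomials have constant
    coefficient 1.\<close>
  moreover have "?m a b (Suc r) - ?m c d (Suc r) = 1"
    unfolding diff coeff_monom_mult by (simp add: coeff_mult_0 coeff_0_path_poly)
  ultimately show ?thesis
    using assms(1) unfolding match_less_def
    by (auto simp: tree_graph_pendent_paths card_verts_pendent_paths intro!: exI[of _ "Suc r"])
qed

lemma P2_less:
  assumes "a < c" "2 * c \<le> n - 3"
  shows "even a \<Longrightarrow> P2 n c \<prec>\<^sub>m P2 n a" and "odd a \<Longrightarrow> P2 n a \<prec>\<^sub>m P2 n c"
proof -
  \<comment> \<open>Since a < c <= n - 3 - c, these subtractions are exact. For odd \<open>a\<close>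
    the sign is absorbed by exchanging the two trees.\<close>
  define u w where "u = c - a - 1" and "w = n - 3 - c - a - 1"
  have eqs: "a + 1 + u = c" "a + 1 + w = n - 3 - c" "a + u + w + 2 = n - 3 - a"
    and sum: "a + (n - 3 - a) = c + (n - 3 - c)"
    using assms by (auto simp: u_def w_def)
  note diff = path_poly_mult_diff[of a u w, unfolded eqs]
  show "P2 n c \<prec>\<^sub>m P2 n a" if "even a"
    unfolding P2_def using sum diff that by (intro match_less_pendent_pathsI) auto
  show "P2 n a \<prec>\<^sub>m P2 n c" if "odd a"
    unfolding P2_def using sum diff that
    by (intro match_less_pendent_pathsI[where r = "a + 1" and u = u and w = w]) (auto simp: algebra_simps)
qed

lemma S_eq_image: "S n = P2 n ` {1..(n - 3) div 2}"
proof
  show "S n \<subseteq> P2 n ` {1..(n - 3) div 2}"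
  proof
    fix T assume "T \<in> S n"
    then obtain a b where ab: "T = pendent_paths [2, a, b]" "a + b = n - 3" "1 \<le> a" "a \<le> b"
      by (auto simp: S_def)
    then have "n - 3 - a = b" "a \<in> {1..(n - 3) div 2}" by auto
    with ab(1) show "T \<in> P2 n ` {1..(n - 3) div 2}" by (auto simp: P2_def)
  qed
  show "P2 n ` {1..(n - 3) div 2} \<subseteq> S n"
  proof
    fix T assume "T \<in> P2 n ` {1..(n - 3) div 2}"
    then obtain a where "T = pendent_paths [2, a, n - 3 - a]" "a + (n - 3 - a) = n - 3" "1 \<le> a" "a \<le> n - 3 - a"
      by (force simp: P2_def)
    then show "T \<in> S n" unfolding S_def by blast
  qed
qed

theorem theorem5p1:
  fixes n k t l :: nat and chain :: "(nat \<times> nat) option sgraph list"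
  assumes "n \<ge> 5"
    and "k = (n - 3) div 2"
    and "t = k div 2"
    and "l = (k - 1) div 2"
    and "chain = map (P2 n) (map (\<lambda>i. 2 * i) [1..<Suc t] @ map (\<lambda>i. 2 * i + 1) (rev [0..<Suc l]))"
  shows "set chain = S n \<and> sorted_wrt (\<succ>\<^sub>m) chain"
proof -
  \<comment> \<open>For k = 0 truncation would give l = 0, and the chain would still contain the
    index 1, beyond k.\<close>
  have k: "1 \<le> k" using assms(1,2) by auto
  have "(\<lambda>i. 2 * i) ` {1..<Suc t} \<union> (\<lambda>i. 2 * i + 1) ` {0..<Suc l} = {1..k}" (is "?L = _")
  proof
    show "?L \<subseteq> {1..k}" using k by (auto simp: assms(3,4))
    show "{1..k} \<subseteq> ?L"
    proof
      fix a assume a: "a \<in> {1..k}"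
      show "a \<in> ?L"
      proof (cases "even a")
        case True
        then have "a = 2 * (a div 2)" "a div 2 \<in> {1..<Suc t}" using a by (auto simp: assms(3))
        then show ?thesis by blast
      next
        case False
        then have "a = 2 * (a div 2) + 1" "a div 2 \<in> {0..<Suc l}"
          using a by (auto simp: assms(4) elim!: oddE)
        then show ?thesis by blast
      qed
    qed
  qed
  then have set_chain: "set chain = S n"
    unfolding assms(5) S_eq_image assms(2)[symmetric]
    by (simp only: set_map set_append set_rev set_upt image_Un[symmetric])
  have small: "2 * (2 * i) \<le> n - 3" if "i \<le> t" for i using that assms(2,3) by auto
  have small': "2 * (2 * i + 1) \<le> n - 3" if "i \<le> l" for i
  proof -
    have "2 * i + 1 \<le> k" using that k by (simp add: assms(4))
    then show ?thesis by (simp add: assms(2))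
  qed
  have "P2 n (2 * j) \<prec>\<^sub>m P2 n (2 * i)" if "i < j" "j \<le> t" for i j
    using that small by (intro P2_less(1)) auto
  then have "sorted_wrt (\<lambda>i j. P2 n (2 * j) \<prec>\<^sub>m P2 n (2 * i)) [1..<Suc t]"
    by (auto intro!: sorted_wrt_mono_rel[OF _ sorted_wrt_upt] simp del: upt_Suc)
  moreover have "P2 n (2 * i + 1) \<prec>\<^sub>m P2 n (2 * j + 1)" if "i < j" "j \<le> l" for i j
    using that small'[of j] by (intro P2_less(2)) auto
  then have "sorted_wrt (\<lambda>i j. P2 n (2 * i + 1) \<prec>\<^sub>m P2 n (2 * j + 1)) [0..<Suc l]"
    by (auto intro!: sorted_wrt_mono_rel[OF _ sorted_wrt_upt] simp del: upt_Suc)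
  \<comment> \<open>The even index wins either way: a smaller even index gives the larger tree, a
    smaller odd index the smaller one.\<close>
  moreover have "P2 n (2 * j + 1) \<prec>\<^sub>m P2 n (2 * i)" if "i \<le> t" "j \<le> l" for i j
  proof (cases "2 * i < 2 * j + 1")
    case True
    then show ?thesis using small'[OF that(2)] by (intro P2_less(1)) auto
  next
    case False
    then have "2 * j + 1 < 2 * i" by presburger
    then show ?thesis using small[OF that(1)] by (intro P2_less(2)) auto
  qed
  ultimately have "sorted_wrt (\<succ>\<^sub>m) chain"
    unfolding assms(5) by (auto simp: sorted_wrt_append sorted_wrt_map sorted_wrt_rev simp del: upt_Suc)
  with set_chain show ?thesis ..
qed

end
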